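(* For every typing context $\Gamma$ of $\Lambda_\cap^s$, $\lambda$-term $M$ and type $A$: $\Gamma\vdash_s M:A$ is derivable in $\Lambda_\cap^s$ if and only if $\Gamma_\cap\vdash M:A$ is derivable in $\Lambda_\cap$.
   Context: $\lambda$-terms: $M::=x\mid MM\mid\lambda x.M$ modulo $\alpha$-conversion; $M[x:=N]$ capture-avoiding substitution. Types: $A::=\varphi\mid A\to A\mid A\cap A$. A typing context is a finite set of pairs $x:A$ ($\Gamma,x:A$ denotes $\Gamma\cup\{x:A\}$; $x\notin\Gamma$ means no $x:B$ lies in $\Gamma$); in $\Lambda_\cap$ its variables are pairwise distinct, in $\Lambda_\cap^s$ a variable may occur with several types. For a context $\Gamma$ of $\Lambda_\cap^s$, $\Gamma_\cap$ is the context in which each variable of $\Gamma$ is assigned the intersection of all the types it has in $\Gamma$. $\Lambda_\cap$: (Ax) $\Gamma,x:A\vdash x:A$; ($\to$I) from $\Gamma,x:A\vdash M:B$, $x\notin\Gamma$, infer $\Gamma\vdash\lambda x.M:A\to B$; ($\to$E) from $\Gamma\vdash M:A\to B$ and $\Gamma\vdash N:A$ infer $\Gamma\vdash MN:B$; ($\cap$I) from $\Gamma\vdash M:A$, $\Gamma\vdash M:B$ infer $\Gamma\vdash M:A\cap B$; ($\cap$E) from $\Gamma\vdash M:A\cap B$ infer $\Gamma\vdash M:A$ and $\Gamma\vdash M:B$. $\Lambda_\cap^s$ ($n\ge0$): (Ax) $\Gamma,x:A\vdash_s x:A$; $(\mathsf{Beta})^s$ from $\Gamma\vdash_s M[x:=N]N_1\dots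 N_n:A$ and $\Gamma\vdash_s N:B$ infer $\Gamma\vdash_s(\lambda x.M)NN_1\dots N_n:A$; $(\mathsf{L}\to)$ from $\Gamma\vdash_s N:A_1$ and $\Gamma,y:A_2\vdash_s yN_1\dots N_n:B$, with $y\notin FV(N_1)\cup\dots\cup FV(N_n)$, $y\notin\Gamma$, infer $\Gamma,x:A_1\to A_2\vdash_s xNN_1\dots N_n:B$; $(\mathsf{R}\to)$ from $\Gamma,x:A\vdash_s M:B$, $x\notin\Gamma$, infer $\Gamma\vdash_s\lambda x.M:A\to B$; $(\mathsf{L}\cap)$ from $\Gamma,x:A_1,x:A_2\vdash_s xN_1\dots N_n:B$ infer $\Gamma,x:A_1\cap A_2\vdash_s xN_1\dots N_n:B$; $(\mathsf{R}\cap)$ from $\Gamma\vdash_s M:A$ and $\Gamma\vdash_s M:B$ infer $\Gamma\vdash_s M:A\cap B$. *)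

theory Defs
  imports Main
begin

text \<open>
  Lambda-terms modulo alpha-conversion are represented in locally nameless style: free variables
  are named, bound variables are de Bruijn indices, and \<open>tm\<close> is the type of the preterms without
  dangling index. Every alpha-equivalence class has exactly one such representative. The named
  abstraction \<open>Lam x M\<close> abstracts the free variable \<open>x\<close> of \<open>M\<close>. The facts \<open>Lam_eq_iff\<close>,
  \<open>FV_simps\<close>, \<open>subst_simps\<close> and \<open>tm_induct\<close> below characterise \<open>tm\<close> and its operations
  up to isomorphism, independently of the representation.
\<close>

datatype ptm = PFree nat | PBound nat | PApp ptm ptm | PAbs ptm

primrec lc_at :: "nat \<Rightarrow> ptm \<Rightarrow> bool" where
  "lc_at k (PFree x) = True"
| "lc_at k (PBound i) = (i < k)"
| "lc_at k (PApp t u) = (lc_at k t \<and> lc_at k u)"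
| "lc_at k (PAbs t) = lc_at (Suc k) t"

primrec pfv :: "ptm \<Rightarrow> nat set" where
  "pfv (PFree x) = {x}"
| "pfv (PBound i) = {}"
| "pfv (PApp t u) = pfv t \<union> pfv u"
| "pfv (PAbs t) = pfv t"

primrec pclose :: "nat \<Rightarrow> nat \<Rightarrow> ptm \<Rightarrow> ptm" where
  "pclose k x (PFree y) = (if y = x then PBound k else PFree y)"
| "pclose k x (PBound i) = PBound i"
| "pclose k x (PApp t u) = PApp (pclose k x t) (pclose k x u)"
| "pclose k x (PAbs t) = PAbs (pclose (Suc k) x t)"

primrec popen :: "nat \<Rightarrow> nat \<Rightarrow> ptm \<Rightarrow> ptm" where
  "popen k x (PFree y) = PFree y"
| "popen k x (PBound i) = (if i = k then PFree x else PBound i)"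
| "popen k x (PApp t u) = PApp (popen k x t) (popen k x u)"
| "popen k x (PAbs t) = PAbs (popen (Suc k) x t)"

text \<open>No index shifting is needed below, since only preterms without dangling index get substituted.\<close>

primrec psubst :: "ptm \<Rightarrow> nat \<Rightarrow> ptm \<Rightarrow> ptm" where
  "psubst (PFree y) x s = (if y = x then s else PFree y)"
| "psubst (PBound i) x s = PBound i"
| "psubst (PApp t u) x s = PApp (psubst t x s) (psubst u x s)"
| "psubst (PAbs t) x s = PAbs (psubst t x s)"

lemma lc_at_mono: "lc_at k t \<Longrightarrow> k \<le> l \<Longrightarrow> lc_at l t"
  by (induction t arbitrary: k l) fastforce+

lemma lc_at_pclose: "lc_at k t \<Longrightarrow> lc_at (Suc k) (pclose k x t)"
  by (induction t arbitrary: k) auto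

lemma lc_at_popen: "lc_at (Suc k) t \<Longrightarrow> lc_at k (popen k x t)"
  by (induction t arbitrary: k) auto

lemma lc_at_psubst: "lc_at k t \<Longrightarrow> lc_at 0 s \<Longrightarrow> lc_at k (psubst t x s)"
  by (induction t arbitrary: k) (auto intro: lc_at_mono)

lemma finite_pfv: "finite (pfv t)"
  by (induction t) auto

lemma pfv_pclose: "pfv (pclose k x t) = pfv t - {x}"
  by (induction t arbitrary: k) auto

lemma popen_pclose: "lc_at k t \<Longrightarrow> popen k x (pclose k y t) = psubst t y (PFree x)"
  by (induction t arbitrary: k) auto

lemma pclose_popen: "x \<notin> pfv t \<Longrightarrow> pclose k x (popen k x t) = t"
  by (induction t arbitrary: k) auto

lemma pclose_psubst_rename: "x \<notin> pfv t \<Longrightarrow> pclose k x (psubst t y (PFree x)) = pclose k y t"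
  by (induction t arbitrary: k) auto

lemma pclose_fresh: "x \<notin> pfv t \<Longrightarrow> pclose k x t = t"
  by (induction t arbitrary: k) auto

lemma psubst_fresh: "x \<notin> pfv t \<Longrightarrow> psubst t x s = t"
  by (induction t) auto

lemma psubst_id: "psubst t x (PFree x) = t"
  by (induction t) auto

lemma psubst_pclose:
  "y \<noteq> x \<Longrightarrow> y \<notin> pfv s \<Longrightarrow> psubst (pclose k y t) x s = pclose k y (psubst t x s)"
  by (induction t arbitrary: k) (auto simp: pclose_fresh)

lemma size_popen: "size (popen k x t) = size t"
  by (induction t arbitrary: k) auto

typedef tm = "{t. lc_at 0 t}"
  by (rule exI[of _ "PFree 0"]) simp

setup_lifting type_definition_tm

lift_definition Var :: "nat \<Rightarrow> tm" is PFree by simp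

lift_definition App :: "tm \<Rightarrow> tm \<Rightarrow> tm" is PApp by simp

lift_definition Lam :: "nat \<Rightarrow> tm \<Rightarrow> tm" is "\<lambda>x t. PAbs (pclose 0 x t)"
  by (simp add: lc_at_pclose)

lift_definition FV :: "tm \<Rightarrow> nat set" is pfv .

lift_definition subst :: "tm \<Rightarrow> nat \<Rightarrow> tm \<Rightarrow> tm" (\<open>_[_ ::= _]\<close> [1000, 0, 0] 1000) is psubst
  by (rule lc_at_psubst)

lemma Var_eq_iff: "Var x = Var y \<longleftrightarrow> x = y"
  by transfer simp

lemma App_eq_iff: "App M N = App M' N' \<longleftrightarrow> M = M' \<and> N = N'"
  by transfer simp

lemma Lam_eq_iff:
  "Lam x M = Lam y N \<longleftrightarrow> x = y \<and> M = N \<or> x \<noteq> y \<and> x \<notin> FV N \<and> M = N[y ::= Var x]"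
proof (transfer, goal_cases)
  case (1 x t y u)
  have "t = psubst u y (PFree x)" if "pclose 0 x t = pclose 0 y u"
    using 1 that by (metis mem_Collect_eq popen_pclose psubst_id)
  moreover have "x \<notin> pfv u" if "pclose 0 x t = pclose 0 y u" "x \<noteq> y"
    using that pfv_pclose[of 0 x t] pfv_pclose[of 0 y u] by auto
  ultimately show ?case
    by (cases "x = y") (auto simp: psubst_id pclose_psubst_rename)
qed

lemma tm_distinct:
  "Var x \<noteq> App M N" "App M N \<noteq> Var x" "Var x \<noteq> Lam y M" "Lam y M \<noteq> Var x"
  "App M N \<noteq> Lam y P" "Lam y P \<noteq> App M N"
  by (transfer, simp)+

lemma FV_simps: "FV (Var x) = {x}" "FV (App M N) = FV M \<union> FV N" "FV (Lam x M) = FV M - {x}"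
  by (transfer, simp add: pfv_pclose)+

lemma finite_FV: "finite (FV M)"
  by transfer (rule finite_pfv)

lemma subst_simps:
  "(Var y)[x ::= P] = (if y = x then P else Var y)"
  "(App M N)[x ::= P] = App (M[x ::= P]) (N[x ::= P])"
  "(Lam x M)[x ::= P] = Lam x M"
  "y \<noteq> x \<Longrightarrow> y \<notin> FV P \<Longrightarrow> (Lam y M)[x ::= P] = Lam y (M[x ::= P])"
  by (transfer, simp add: psubst_fresh pfv_pclose psubst_pclose)+

lemma tm_induct:
  assumes "finite X"
    and var: "\<And>x. P (Var x)"
    and app: "\<And>M N. P M \<Longrightarrow> P N \<Longrightarrow> P (App M N)"
    and lam: "\<And>x M. x \<notin> X \<Longrightarrow> P M \<Longrightarrow> P (Lam x M)"
  shows "P M"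
proof -
  have "P (Abs_tm t)" if "lc_at 0 t" for t
    using that
  proof (induction t rule: measure_induct_rule[of size])
    case (less t)
    show ?case
    proof (cases t)
      case (PFree x)
      then show ?thesis using var[of x] by (simp add: Var_def)
    next
      case (PBound i)
      then show ?thesis using less.prems by simp
    next
      case (PApp u v)
      then have "P (App (Abs_tm u) (Abs_tm v))"
        using less by (intro app) auto
      then show ?thesis
        using PApp less.prems by (simp add: App_def Abs_tm_inverse)
    next
      case (PAbs u)
      obtain x where x: "x \<notin> X \<union> pfv u"
        using ex_new_if_finite[of "X \<union> pfv u"] finite_pfv \<open>finite X\<close> by auto
      have lc: "lc_at 0 (popen 0 x u)"
        using PAbs less.prems by (simp add: lc_at_popen)
      then have "P (Lam x (Abs_tm (popen 0 x u)))"
        using PAbs x by (intro lam less.IH) (auto simp: size_popen)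
      then show ?thesis
        using PAbs x lc by (simp add: Lam_def Abs_tm_inverse pclose_popen)
    qed
  qed
  then show ?thesis
    by (cases M) simp
qed

abbreviation apps :: "tm \<Rightarrow> tm list \<Rightarrow> tm" where
  "apps M Ns \<equiv> foldl App M Ns"


datatype 'a ty =
    Atom 'a
  | Arrow "'a ty" "'a ty" (infixr \<open>\<^bold>\<rightarrow>\<close> 65)
  | Inter "'a ty" "'a ty" (infixr \<open>\<^bold>\<inter>\<close> 70)

type_synonym 'a ctx = "(nat \<times> 'a ty) set"

text \<open>
  The set \<open>Domain \<Gamma>\<close> consists of the variables occurring in \<open>\<Gamma>\<close>. That the contexts are
  finite, and in the first system that their variables are pairwise distinct (\<open>single_valued\<close>),
  is required in the axioms only; the other rules preserve it, as the two lemmas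
  following the definitions show.
\<close>

inductive typing :: "'a ctx \<Rightarrow> tm \<Rightarrow> 'a ty \<Rightarrow> bool"
  (\<open>_ \<turnstile> _ \<Ztypecolon> _\<close> [50, 50, 50] 50) where
  Ax: "finite \<Gamma> \<Longrightarrow> single_valued (insert (x, A) \<Gamma>) \<Longrightarrow> insert (x, A) \<Gamma> \<turnstile> Var x \<Ztypecolon> A"
| ArrI: "insert (x, A) \<Gamma> \<turnstile> M \<Ztypecolon> B \<Longrightarrow> x \<notin> Domain \<Gamma> \<Longrightarrow> \<Gamma> \<turnstile> Lam x M \<Ztypecolon> A \<^bold>\<rightarrow> B"
| ArrE: "\<Gamma> \<turnstile> M \<Ztypecolon> A \<^bold>\<rightarrow> B \<Longrightarrow> \<Gamma> \<turnstile> N \<Ztypecolon> A \<Longrightarrow> \<Gamma> \<turnstile> App M N \<Ztypecolon> B"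
| IntI: "\<Gamma> \<turnstile> M \<Ztypecolon> A \<Longrightarrow> \<Gamma> \<turnstile> M \<Ztypecolon> B \<Longrightarrow> \<Gamma> \<turnstile> M \<Ztypecolon> A \<^bold>\<inter> B"
| IntE1: "\<Gamma> \<turnstile> M \<Ztypecolon> A \<^bold>\<inter> B \<Longrightarrow> \<Gamma> \<turnstile> M \<Ztypecolon> A"
| IntE2: "\<Gamma> \<turnstile> M \<Ztypecolon> A \<^bold>\<inter> B \<Longrightarrow> \<Gamma> \<turnstile> M \<Ztypecolon> B"

inductive styping :: "'a ctx \<Rightarrow> tm \<Rightarrow> 'a ty \<Rightarrow> bool"
  (\<open>_ \<turnstile>\<^sub>s _ \<Ztypecolon> _\<close> [50, 50, 50] 50) where
  sAx: "finite \<Gamma> \<Longrightarrow> insert (x, A) \<Gamma> \<turnstile>\<^sub>s Var x \<Ztypecolon> A"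
| sBeta: "\<Gamma> \<turnstile>\<^sub>s apps (M[x ::= N]) Ns \<Ztypecolon> A \<Longrightarrow> \<Gamma> \<turnstile>\<^sub>s N \<Ztypecolon> B \<Longrightarrow>
    \<Gamma> \<turnstile>\<^sub>s apps (App (Lam x M) N) Ns \<Ztypecolon> A"
| sArrL: "\<Gamma> \<turnstile>\<^sub>s N \<Ztypecolon> A1 \<Longrightarrow> insert (y, A2) \<Gamma> \<turnstile>\<^sub>s apps (Var y) Ns \<Ztypecolon> B \<Longrightarrow>
    y \<notin> (\<Union>P\<in>set Ns. FV P) \<Longrightarrow> y \<notin> Domain \<Gamma> \<Longrightarrow>
    insert (x, A1 \<^bold>\<rightarrow> A2) \<Gamma> \<turnstile>\<^sub>s apps (App (Var x) N) Ns \<Ztypecolon> B"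
| sArrR: "insert (x, A) \<Gamma> \<turnstile>\<^sub>s M \<Ztypecolon> B \<Longrightarrow> x \<notin> Domain \<Gamma> \<Longrightarrow> \<Gamma> \<turnstile>\<^sub>s Lam x M \<Ztypecolon> A \<^bold>\<rightarrow> B"
| sIntL: "insert (x, A1) (insert (x, A2) \<Gamma>) \<turnstile>\<^sub>s apps (Var x) Ns \<Ztypecolon> B \<Longrightarrow>
    insert (x, A1 \<^bold>\<inter> A2) \<Gamma> \<turnstile>\<^sub>s apps (Var x) Ns \<Ztypecolon> B"
| sIntR: "\<Gamma> \<turnstile>\<^sub>s M \<Ztypecolon> A \<Longrightarrow> \<Gamma> \<turnstile>\<^sub>s M \<Ztypecolon> B \<Longrightarrow> \<Gamma> \<turnstile>\<^sub>s M \<Ztypecolon> A \<^bold>\<inter> B"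

lemma typing_ctx: "\<Gamma> \<turnstile> M \<Ztypecolon> A \<Longrightarrow> finite \<Gamma> \<and> single_valued \<Gamma>"
  by (induction rule: typing.induct) (auto intro: single_valued_subset[OF subset_insertI])

lemma styping_ctx: "\<Gamma> \<turnstile>\<^sub>s M \<Ztypecolon> A \<Longrightarrow> finite \<Gamma>"
  by (induction rule: styping.induct) auto

text \<open>
  \<open>is_Inter S A\<close>: the type \<open>A\<close> is an intersection of all the types in \<open>S\<close>, each taken once.
  Types are not identified up to associativity and commutativity of the intersection, so \<open>A\<close> is
  determined only up to the order and the bracketing. Accordingly \<open>is_inter_ctx \<Gamma> \<Delta>\<close> states
  that \<open>\<Delta>\<close> is the intersection context of \<open>\<Gamma>\<close> for some choice of these.
\<close>

inductive is_Inter :: "'a ty set \<Rightarrow> 'a ty \<Rightarrow> bool" where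
  single: "is_Inter {A} A"
| union: "is_Inter S A \<Longrightarrow> is_Inter T B \<Longrightarrow> S \<inter> T = {} \<Longrightarrow> is_Inter (S \<union> T) (A \<^bold>\<inter> B)"

definition is_inter_ctx :: "'a ctx \<Rightarrow> 'a ctx \<Rightarrow> bool" where
  "is_inter_ctx \<Gamma> \<Delta> \<longleftrightarrow> single_valued \<Delta> \<and> Domain \<Delta> = Domain \<Gamma> \<and>
     (\<forall>(x, A) \<in> \<Delta>. is_Inter {B. (x, B) \<in> \<Gamma>} A)"

lemma is_Inter_exists: "finite S \<Longrightarrow> S \<noteq> {} \<Longrightarrow> \<exists>A. is_Inter S A"
proof (induction rule: finite_ne_induct)
  case (singleton A)
  then show ?case by (blast intro: is_Inter.single)
next
  case (insert A S)
  then obtain B where "is_Inter S B" by blast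
  then have "is_Inter ({A} \<union> S) (A \<^bold>\<inter> B)"
    using insert by (intro is_Inter.intros) auto
  then show ?case by auto
qed

lemma is_inter_ctx_exists:
  assumes "finite \<Gamma>"
  shows "\<exists>\<Delta>. is_inter_ctx \<Gamma> \<Delta>"
proof -
  have "\<exists>A. is_Inter {B. (x, B) \<in> \<Gamma>} A" if "x \<in> Domain \<Gamma>" for x
  proof (rule is_Inter_exists)
    have "{B. (x, B) \<in> \<Gamma>} \<subseteq> snd ` \<Gamma>" by force
    then show "finite {B. (x, B) \<in> \<Gamma>}" using assms finite_surj by blast
  qed (use that in auto)
  then obtain f where "\<And>x. x \<in> Domain \<Gamma> \<Longrightarrow> is_Inter {B. (x, B) \<in> \<Gamma>} (f x)"
    by metis
  then have "is_inter_ctx \<Gamma> {(x, f x) | x. x \<in> Domain \<Gamma>}"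
    by (auto simp: is_inter_ctx_def single_valued_def)
  then show ?thesis ..
qed

lemma is_inter_ctx_finite:
  assumes "finite \<Gamma>" "is_inter_ctx \<Gamma> \<Delta>"
  shows "finite \<Delta>"
proof (rule inj_on_finite)
  show "inj_on fst \<Delta>"
    using assms(2) by (auto simp: is_inter_ctx_def single_valued_def inj_on_def)
  show "fst ` \<Delta> \<subseteq> Domain \<Gamma>"
    using assms(2) by (simp add: is_inter_ctx_def Domain_fst)
  show "finite (Domain \<Gamma>)"
    using assms(1) by (rule finite_Domain)
qed

end

theory Submission
  imports Defs
begin

text \<open>
  From left to right one passes through natural deduction with multi-valued contexts: there
  \<open>sBeta\<close> becomes subject expansion, where the finitely many types used for the copies of the
  argument are collected in one intersection, and \<open>sArrL\<close> becomes a substitution.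

  From right to left, instead of eliminating cuts, one uses a Kripke-style reducibility relation
  over the sequent calculus. The clause for \<open>A \<^bold>\<rightarrow> B\<close> asks for derivability in addition to
  the function space condition: derivability cannot be recovered from the latter, since the calculus
  does not satisfy eta. For instance \<open>y : A \<^bold>\<rightarrow> C\<close> and \<open>x : A \<^bold>\<inter> B\<close> yield
  \<open>y x : C\<close>, but \<open>y : A \<^bold>\<rightarrow> C\<close> does not yield \<open>y : A \<^bold>\<inter> B \<^bold>\<rightarrow> C\<close>.
\<close>

section \<open>Parallel substitution\<close>

text \<open>Simultaneous substitution serves here because renamings and assignments of reducible
  terms act on all variables at once, and because it is closed under composition. Only images
  without dangling indices are used, hence no shifting.\<close>

primrec pmsubst :: "ptm \<Rightarrow> (nat \<Rightarrow> ptm) \<Rightarrow> ptm" where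
  "pmsubst (PFree y) f = f y"
| "pmsubst (PBound i) f = PBound i"
| "pmsubst (PApp t u) f = PApp (pmsubst t f) (pmsubst u f)"
| "pmsubst (PAbs t) f = PAbs (pmsubst t f)"

lemma lc_at_pmsubst: "lc_at k t \<Longrightarrow> (\<And>x. lc_at 0 (f x)) \<Longrightarrow> lc_at k (pmsubst t f)"
  by (induction t arbitrary: k) (auto intro: lc_at_mono)

text \<open>This is the choice of a new bound name: every free \<open>y\<close> in the substituted
  term stems from \<open>x\<close>, so abstracting \<open>y\<close> restores exactly the binding of
  \<open>x\<close>.\<close>

lemma pmsubst_pclose:
  "(\<And>z. z \<in> pfv t - {x} \<Longrightarrow> y \<notin> pfv (f z)) \<Longrightarrow>
    pmsubst (pclose k x t) f = pclose k y (pmsubst t (f(x := PFree y)))"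
  by (induction t arbitrary: k) (auto simp: pclose_fresh)

lemma pmsubst_cong: "(\<And>z. z \<in> pfv t \<Longrightarrow> f z = g z) \<Longrightarrow> pmsubst t f = pmsubst t g"
  by (induction t) auto

lemma pmsubst_pmsubst: "pmsubst (pmsubst t f) g = pmsubst t (\<lambda>x. pmsubst (f x) g)"
  by (induction t) auto

lemma pmsubst_PFree: "pmsubst t PFree = t"
  by (induction t) auto

lemma psubst_eq_pmsubst: "psubst t x s = pmsubst t (PFree(x := s))"
  by (induction t) auto

lift_definition msubst :: "tm \<Rightarrow> (nat \<Rightarrow> tm) \<Rightarrow> tm" is pmsubst
  by (rule lc_at_pmsubst) auto

lemma msubst_simps [simp]:
  "msubst (Var x) f = f x"
  "msubst (App M N) f = App (msubst M f) (msubst N f)"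
  by (transfer, simp)+

lemma msubst_Lam:
  "(\<And>z. z \<in> FV M - {x} \<Longrightarrow> y \<notin> FV (f z)) \<Longrightarrow>
    msubst (Lam x M) f = Lam y (msubst M (f(x := Var y)))"
  by transfer (auto intro: pmsubst_pclose)

lemma msubst_cong: "(\<And>z. z \<in> FV M \<Longrightarrow> f z = g z) \<Longrightarrow> msubst M f = msubst M g"
  by transfer (auto intro: pmsubst_cong)

lemma msubst_msubst: "msubst (msubst M f) g = msubst M (\<lambda>x. msubst (f x) g)"
  by transfer (rule pmsubst_pmsubst)

lemma msubst_Var [simp]: "msubst M Var = M"
  by transfer (rule pmsubst_PFree)

lemma subst_eq_msubst: "M[x ::= N] = msubst M (Var(x := N))"
  by transfer (simp add: psubst_eq_pmsubst)

lemma msubst_fresh: "(\<And>z. z \<in> FV M \<Longrightarrow> f z = Var z) \<Longrightarrow> msubst M f = M"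
  using msubst_cong[of M f Var] by simp

lemma msubst_apps: "msubst (apps M Ns) f = apps (msubst M f) (map (\<lambda>N. msubst N f) Ns)"
  by (induction Ns arbitrary: M) auto

text \<open>As \<open>y\<close> avoids the images of all free variables of \<open>M\<close>, a later
  substitution for \<open>y\<close> reaches only the former places of \<open>x\<close>; hence the
  last equation.\<close>

lemma msubst_Lam_fresh:
  assumes "finite X"
  obtains y where "y \<notin> X" "msubst (Lam x M) f = Lam y (msubst M (f(x := Var y)))"
    "\<And>N. (msubst M (f(x := Var y)))[y ::= N] = msubst M (f(x := N))"
proof -
  obtain y where y: "y \<notin> X \<union> (\<Union>z\<in>FV M. FV (f z))"
    using ex_new_if_finite[of "X \<union> (\<Union>z\<in>FV M. FV (f z))"] assms finite_FV by auto
  show thesis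
  proof
    show "y \<notin> X" using y by simp
    show "msubst (Lam x M) f = Lam y (msubst M (f(x := Var y)))"
      using y by (intro msubst_Lam) auto
    show "(msubst M (f(x := Var y)))[y ::= N] = msubst M (f(x := N))" for N
      unfolding subst_eq_msubst msubst_msubst
      using y by (intro msubst_cong) (auto intro!: msubst_fresh)
  qed
qed

lemma Lam_fresh:
  assumes "finite X"
  obtains y M' where "y \<notin> X" "Lam x M = Lam y M'" "\<And>N. M'[y ::= N] = M[x ::= N]"
proof -
  obtain y where "y \<notin> X" "msubst (Lam x M) Var = Lam y (msubst M (Var(x := Var y)))"
    "\<And>N. (msubst M (Var(x := Var y)))[y ::= N] = msubst M (Var(x := N))"
    using msubst_Lam_fresh[OF assms, of x M Var] by metis
  then show thesis
    using that by (simp add: subst_eq_msubst)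
qed

text \<open>The induction hypothesis for an abstraction covers all its alpha-variants, so that
  the bound variable can be chosen fresh for a context that varies during the induction.\<close>

lemma tm_alpha_induct [case_names Var App Lam]:
  assumes var: "\<And>x. P (Var x)"
    and app: "\<And>M N. P M \<Longrightarrow> P N \<Longrightarrow> P (App M N)"
    and lam: "\<And>x M. (\<And>y M'. Lam x M = Lam y M' \<Longrightarrow> P M') \<Longrightarrow> P (Lam x M)"
  shows "P M"
proof -
  \<comment> \<open>Strengthened to all variable renamings of \<open>M\<close>: an alpha-variant of
    the body of a renamed abstraction is again a renaming of the original body.\<close>
  have "\<forall>f. P (msubst M (\<lambda>x. Var (f x)))"
  proof (rule tm_induct[of "{}"])
    fix x M assume IH: "\<forall>f. P (msubst M (\<lambda>x. Var (f x)))"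
    show "\<forall>f. P (msubst (Lam x M) (\<lambda>x. Var (f x)))"
    proof
      fix f
      obtain y where y: "msubst (Lam x M) (\<lambda>x. Var (f x)) = Lam y (msubst M ((\<lambda>x. Var (f x))(x := Var y)))"
        "\<And>N. (msubst M ((\<lambda>x. Var (f x))(x := Var y)))[y ::= N] = msubst M ((\<lambda>x. Var (f x))(x := N))"
        using msubst_Lam_fresh[of "{}" x M "\<lambda>x. Var (f x)"] by (metis finite.emptyI)
      have "P M'" if "Lam y (msubst M ((\<lambda>x. Var (f x))(x := Var y))) = Lam z M'" for z M'
      proof -
        have "M' = (msubst M ((\<lambda>x. Var (f x))(x := Var y)))[y ::= Var z]"
          using that[symmetric] by (auto simp: Lam_eq_iff subst_eq_msubst)
        then have "M' = msubst M (\<lambda>u. Var ((f(x := z)) u))"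
          using y(2) by (simp add: fun_upd_def if_distrib)
        then show ?thesis using IH by blast
      qed
      then show "P (msubst (Lam x M) (\<lambda>x. Var (f x)))"
        unfolding y(1) by (rule lam)
    qed
  qed (auto intro: var app)
  then have "P (msubst M (\<lambda>x. Var x))" ..
  then show ?thesis by simp
qed

section \<open>Natural deduction with multi-valued contexts\<close>

inductive mtyping :: "'a ctx \<Rightarrow> tm \<Rightarrow> 'a ty \<Rightarrow> bool"
  (\<open>_ \<turnstile>\<^sub>m _ \<Ztypecolon> _\<close> [50, 50, 50] 50) where
  mAx: "finite \<Gamma> \<Longrightarrow> (x, A) \<in> \<Gamma> \<Longrightarrow> \<Gamma> \<turnstile>\<^sub>m Var x \<Ztypecolon> A"
| mArrI: "insert (x, A) \<Gamma> \<turnstile>\<^sub>m M \<Ztypecolon> B \<Longrightarrow> x \<notin> Domain \<Gamma> \<Longrightarrow> \<Gamma> \<turnstile>\<^sub>m Lam x M \<Ztypecolon> A \<^bold>\<rightarrow> B"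
| mArrE: "\<Gamma> \<turnstile>\<^sub>m M \<Ztypecolon> A \<^bold>\<rightarrow> B \<Longrightarrow> \<Gamma> \<turnstile>\<^sub>m N \<Ztypecolon> A \<Longrightarrow> \<Gamma> \<turnstile>\<^sub>m App M N \<Ztypecolon> B"
| mIntI: "\<Gamma> \<turnstile>\<^sub>m M \<Ztypecolon> A \<Longrightarrow> \<Gamma> \<turnstile>\<^sub>m M \<Ztypecolon> B \<Longrightarrow> \<Gamma> \<turnstile>\<^sub>m M \<Ztypecolon> A \<^bold>\<inter> B"
| mIntE1: "\<Gamma> \<turnstile>\<^sub>m M \<Ztypecolon> A \<^bold>\<inter> B \<Longrightarrow> \<Gamma> \<turnstile>\<^sub>m M \<Ztypecolon> A"
| mIntE2: "\<Gamma> \<turnstile>\<^sub>m M \<Ztypecolon> A \<^bold>\<inter> B \<Longrightarrow> \<Gamma> \<turnstile>\<^sub>m M \<Ztypecolon> B"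

lemma mtyping_finite: "\<Gamma> \<turnstile>\<^sub>m M \<Ztypecolon> A \<Longrightarrow> finite \<Gamma>"
  by (induction rule: mtyping.induct) auto

text \<open>Read upwards, only \<open>mArrI\<close> enlarges the context, and it adds a fresh
  variable, so single-valuedness reaches every premise.\<close>

lemma mtyping_imp_typing: "\<Gamma> \<turnstile>\<^sub>m M \<Ztypecolon> A \<Longrightarrow> single_valued \<Gamma> \<Longrightarrow> \<Gamma> \<turnstile> M \<Ztypecolon> A"
proof (induction rule: mtyping.induct)
  case (mAx \<Gamma> x A)
  then show ?case using typing.Ax[of \<Gamma> x A] by (simp add: insert_absorb)
next
  case (mArrI x A \<Gamma> M B)
  then have "single_valued (insert (x, A) \<Gamma>)"
    by (auto simp: single_valued_def)
  then show ?case using mArrI by (intro typing.ArrI)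
qed (blast intro: typing.intros)+

lemma finite_Domain_fresh:
  fixes \<Gamma> :: "(nat \<times> 'b) set"
  assumes "finite \<Gamma>" "finite X"
  obtains y where "y \<notin> Domain \<Gamma>" "y \<notin> X"
  using ex_new_if_finite[of "Domain \<Gamma> \<union> X"] assms by (auto simp: finite_Domain)

text \<open>The substitution lemma relative to a class \<open>Q\<close> of typings for the substituted terms,
  to be applied first with variables only (renaming, weakening) and then with all derivable typings,
  which are closed under weakening by the first application.\<close>

lemma mtyping_msubst_generic:
  assumes Q: "\<And>\<Gamma> M A. Q \<Gamma> M A \<Longrightarrow> \<Gamma> \<turnstile>\<^sub>m M \<Ztypecolon> A"
    and Q_weaken: "\<And>\<Gamma> \<Gamma>' M A. Q \<Gamma> M A \<Longrightarrow> \<Gamma> \<subseteq> \<Gamma>' \<Longrightarrow> finite \<Gamma>' \<Longrightarrow> Q \<Gamma>' M A"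
    and Q_Var: "\<And>\<Gamma> x A. finite \<Gamma> \<Longrightarrow> (x, A) \<in> \<Gamma> \<Longrightarrow> Q \<Gamma> (Var x) A"
    and "\<Gamma> \<turnstile>\<^sub>m M \<Ztypecolon> A" "finite \<Gamma>'"
    and "\<And>x B. (x, B) \<in> \<Gamma> \<Longrightarrow> x \<in> FV M \<Longrightarrow> Q \<Gamma>' (f x) B"
  shows "\<Gamma>' \<turnstile>\<^sub>m msubst M f \<Ztypecolon> A"
  using assms(4-)
proof (induction arbitrary: \<Gamma>' f rule: mtyping.induct)
  case (mAx \<Gamma> x A)
  then show ?case by (auto simp: FV_simps intro: Q)
next
  case (mArrI x A \<Gamma> M B)
  obtain y where y: "y \<notin> Domain \<Gamma>'" "msubst (Lam x M) f = Lam y (msubst M (f(x := Var y)))"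
    using msubst_Lam_fresh[of "Domain \<Gamma>'" x M f] mArrI.prems(1) by (metis finite_Domain)
  have "insert (y, A) \<Gamma>' \<turnstile>\<^sub>m msubst M (f(x := Var y)) \<Ztypecolon> B"
  proof (rule mArrI.IH)
    fix z C assume "(z, C) \<in> insert (x, A) \<Gamma>" "z \<in> FV M"
    then show "Q (insert (y, A) \<Gamma>') ((f(x := Var y)) z) C"
      using mArrI.prems mArrI.hyps
      by (cases "z = x") (auto simp: FV_simps intro!: Q_Var intro: Q_weaken)
  qed (use mArrI.prems in simp)
  then show ?case
    unfolding y(2) using y(1) by (rule mtyping.mArrI)
next
  case (mArrE \<Gamma> M A B N)
  have "\<Gamma>' \<turnstile>\<^sub>m msubst M f \<Ztypecolon> A \<^bold>\<rightarrow> B" "\<Gamma>' \<turnstile>\<^sub>m msubst N f \<Ztypecolon> A"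
    using mArrE.prems by (auto simp: FV_simps intro: mArrE.IH)
  then show ?case by (auto intro: mtyping.mArrE)
next
  case (mIntI \<Gamma> M A B)
  then show ?case by (intro mtyping.mIntI) auto
next
  case (mIntE1 \<Gamma> M A B)
  show ?case by (rule mtyping.mIntE1[of _ _ A B], rule mIntE1.IH; fact)
next
  case (mIntE2 \<Gamma> M A B)
  show ?case by (rule mtyping.mIntE2[of _ _ A B], rule mIntE2.IH; fact)
qed

lemma mtyping_rename:
  assumes "\<Gamma> \<turnstile>\<^sub>m M \<Ztypecolon> A" "finite \<Gamma>'"
    and "\<And>x B. (x, B) \<in> \<Gamma> \<Longrightarrow> x \<in> FV M \<Longrightarrow> (f x, B) \<in> \<Gamma>'"
  shows "\<Gamma>' \<turnstile>\<^sub>m msubst M (\<lambda>x. Var (f x)) \<Ztypecolon> A"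
  by (rule mtyping_msubst_generic[where Q = "\<lambda>\<Gamma> M A. \<exists>x. M = Var x \<and> (x, A) \<in> \<Gamma> \<and> finite \<Gamma>", OF _ _ _ assms(1,2)])
    (use assms in \<open>auto intro: mAx\<close>)

text \<open>The identity renaming gives weakening and also the removal of assumptions on variables
  that are not free in \<open>M\<close>.\<close>

lemma mtyping_cong_ctx:
  "\<Gamma> \<turnstile>\<^sub>m M \<Ztypecolon> A \<Longrightarrow> finite \<Gamma>' \<Longrightarrow> (\<And>x B. (x, B) \<in> \<Gamma> \<Longrightarrow> x \<in> FV M \<Longrightarrow> (x, B) \<in> \<Gamma>') \<Longrightarrow>
    \<Gamma>' \<turnstile>\<^sub>m M \<Ztypecolon> A"
  using mtyping_rename[of \<Gamma> M A \<Gamma>' "\<lambda>x. x"] by simp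

lemma mtyping_msubst:
  assumes "\<Gamma> \<turnstile>\<^sub>m M \<Ztypecolon> A" "finite \<Gamma>'"
    and "\<And>x B. (x, B) \<in> \<Gamma> \<Longrightarrow> x \<in> FV M \<Longrightarrow> \<Gamma>' \<turnstile>\<^sub>m f x \<Ztypecolon> B"
  shows "\<Gamma>' \<turnstile>\<^sub>m msubst M f \<Ztypecolon> A"
  by (rule mtyping_msubst_generic[where Q = mtyping, OF _ _ _ assms(1,2)])
    (use assms in \<open>auto intro: mAx mtyping_cong_ctx\<close>)

text \<open>A typing of an application is built from instances of \<open>mArrE\<close> by
  intersection rules alone, so inversion takes the form of an induction over types.\<close>

lemma mtyping_App_elim [consumes 1, case_names ArrE IntI IntE1 IntE2]:
  assumes "\<Gamma> \<turnstile>\<^sub>m App M N \<Ztypecolon> A"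
    and "\<And>A B. \<Gamma> \<turnstile>\<^sub>m M \<Ztypecolon> A \<^bold>\<rightarrow> B \<Longrightarrow> \<Gamma> \<turnstile>\<^sub>m N \<Ztypecolon> A \<Longrightarrow> P B"
    and "\<And>A B. P A \<Longrightarrow> P B \<Longrightarrow> P (A \<^bold>\<inter> B)"
    and "\<And>A B. P (A \<^bold>\<inter> B) \<Longrightarrow> P A"
    and "\<And>A B. P (A \<^bold>\<inter> B) \<Longrightarrow> P B"
  shows "P A"
  using assms
proof (induction \<Gamma> "App M N" A rule: mtyping.induct)
  case (mArrE \<Gamma> M' A B N')
  then show ?case unfolding App_eq_iff by blast
next
  case (mIntI \<Gamma> A B)
  show ?case by (rule mIntI.prems(2); rule mIntI.hyps; fact)
next
  case (mIntE1 \<Gamma> A B)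
  show ?case by (rule mIntE1.prems(3)[of A B], rule mIntE1.hyps; fact)
next
  case (mIntE2 \<Gamma> A B)
  show ?case by (rule mIntE2.prems(4)[of A B], rule mIntE2.hyps; fact)
next
  case (mAx \<Gamma> x A)
  from mAx.hyps(3) show ?case by (simp add: tm_distinct)
next
  case (mArrI x A \<Gamma> M B)
  from mArrI.hyps(4) show ?case by (simp add: tm_distinct)
qed

text \<open>Inversion as for applications, with the bound variable prescribed in advance so that
  callers can choose it fresh.\<close>

lemma mtyping_Lam_elim [consumes 2, case_names ArrI IntI IntE1 IntE2]:
  assumes "\<Gamma> \<turnstile>\<^sub>m Lam x M \<Ztypecolon> A" "x \<notin> Domain \<Gamma>"
    and "\<And>A B. insert (x, A) \<Gamma> \<turnstile>\<^sub>m M \<Ztypecolon> B \<Longrightarrow> P (A \<^bold>\<rightarrow> B)"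
    and "\<And>A B. P A \<Longrightarrow> P B \<Longrightarrow> P (A \<^bold>\<inter> B)"
    and "\<And>A B. P (A \<^bold>\<inter> B) \<Longrightarrow> P A"
    and "\<And>A B. P (A \<^bold>\<inter> B) \<Longrightarrow> P B"
  shows "P A"
  using assms
proof (induction \<Gamma> "Lam x M" A rule: mtyping.induct)
  case (mArrI y A \<Gamma> M' B)
  \<comment> \<open>The rule instance may bind another variable \<open>y\<close>. Alpha-equivalence
    makes \<open>M\<close> the renaming of \<open>M'\<close> from \<open>y\<close> to
    \<open>x\<close>, and typings are stable under renaming.\<close>
  have "M = msubst M' (\<lambda>z. Var ((id(y := x)) z))"
  proof -
    have "M = M'[y ::= Var x]"
      using mArrI.hyps(4)[symmetric] by (auto simp: Lam_eq_iff subst_eq_msubst)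
    then show ?thesis
      by (auto simp: subst_eq_msubst intro: msubst_cong)
  qed
  moreover have "insert (x, A) \<Gamma> \<turnstile>\<^sub>m msubst M' (\<lambda>z. Var ((id(y := x)) z)) \<Ztypecolon> B"
    using mtyping_finite[OF mArrI.hyps(1)] mArrI.hyps(3)
    by (intro mtyping_rename[OF mArrI.hyps(1)]) auto
  ultimately show ?case by (intro mArrI.prems(2)) simp
next
  case (mIntI \<Gamma> A B)
  show ?case by (rule mIntI.prems(3); rule mIntI.hyps; fact)
next
  case (mIntE1 \<Gamma> A B)
  show ?case by (rule mIntE1.prems(4)[of A B], rule mIntE1.hyps; fact)
next
  case (mIntE2 \<Gamma> A B)
  show ?case by (rule mIntE2.prems(5)[of A B], rule mIntE2.hyps; fact)
next
  case (mAx \<Gamma> y A)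
  from mAx.hyps(3) show ?case by (simp add: tm_distinct)
next
  case (mArrE \<Gamma> M A B N)
  from mArrE.hyps(5) show ?case by (simp add: tm_distinct)
qed

lemma mtyping_is_Inter:
  assumes "is_Inter S A"
  shows "\<Gamma> \<turnstile>\<^sub>m M \<Ztypecolon> A \<longleftrightarrow> (\<forall>C\<in>S. \<Gamma> \<turnstile>\<^sub>m M \<Ztypecolon> C)"
  using assms by induction (auto intro: mtyping.intros)

section \<open>Subject expansion\<close>

text \<open>\<open>S\<close> collects the types at which the copies of \<open>N\<close> are used.
  Multi-valued contexts let it remain a set, possibly empty, so that two derivations are combined by
  a union and weakening.\<close>

definition expandable :: "'a ctx \<Rightarrow> nat \<Rightarrow> tm \<Rightarrow> tm \<Rightarrow> 'a ty \<Rightarrow> bool" where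
  "expandable \<Gamma> x N M A \<longleftrightarrow>
    (\<exists>S. finite S \<and> (\<forall>C\<in>S. \<Gamma> \<turnstile>\<^sub>m N \<Ztypecolon> C) \<and> \<Gamma> \<union> {x} \<times> S \<turnstile>\<^sub>m M \<Ztypecolon> A)"

lemma expandable_common:
  assumes "expandable \<Gamma> x N M A" "expandable \<Gamma> x N M' B"
  obtains S where "finite S" "\<forall>C\<in>S. \<Gamma> \<turnstile>\<^sub>m N \<Ztypecolon> C"
    "\<Gamma> \<union> {x} \<times> S \<turnstile>\<^sub>m M \<Ztypecolon> A" "\<Gamma> \<union> {x} \<times> S \<turnstile>\<^sub>m M' \<Ztypecolon> B"
proof -
  obtain S T where S: "finite S" "\<forall>C\<in>S. \<Gamma> \<turnstile>\<^sub>m N \<Ztypecolon> C" "\<Gamma> \<union> {x} \<times> S \<turnstile>\<^sub>m M \<Ztypecolon> A"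
    and T: "finite T" "\<forall>C\<in>T. \<Gamma> \<turnstile>\<^sub>m N \<Ztypecolon> C" "\<Gamma> \<union> {x} \<times> T \<turnstile>\<^sub>m M' \<Ztypecolon> B"
    using assms unfolding expandable_def by blast
  have "finite \<Gamma>" using mtyping_finite[OF S(3)] by simp
  show thesis
  proof
    show "\<Gamma> \<union> {x} \<times> (S \<union> T) \<turnstile>\<^sub>m M \<Ztypecolon> A" "\<Gamma> \<union> {x} \<times> (S \<union> T) \<turnstile>\<^sub>m M' \<Ztypecolon> B"
      using S(1) T(1) \<open>finite \<Gamma>\<close>
      by (auto intro: mtyping_cong_ctx[OF S(3)] mtyping_cong_ctx[OF T(3)])
  qed (use S T in auto)
qed

lemma expandable_IntI:
  "expandable \<Gamma> x N M A \<Longrightarrow> expandable \<Gamma> x N M B \<Longrightarrow> expandable \<Gamma> x N M (A \<^bold>\<inter> B)"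
  by (erule (1) expandable_common) (auto simp: expandable_def intro: mIntI)

lemma expandable_IntE:
  "expandable \<Gamma> x N M (A \<^bold>\<inter> B) \<Longrightarrow> expandable \<Gamma> x N M A"
  "expandable \<Gamma> x N M (A \<^bold>\<inter> B) \<Longrightarrow> expandable \<Gamma> x N M B"
  unfolding expandable_def by (blast intro: mIntE1 mIntE2)+

lemma mtyping_subst_expandable:
  "\<Gamma> \<turnstile>\<^sub>m M[x ::= N] \<Ztypecolon> A \<Longrightarrow> x \<notin> Domain \<Gamma> \<Longrightarrow> expandable \<Gamma> x N M A"
proof (induction M arbitrary: \<Gamma> A rule: tm_alpha_induct)
  case (Var z)
  show ?case
  proof (cases "z = x")
    case True
    then have "\<Gamma> \<turnstile>\<^sub>m N \<Ztypecolon> A" using Var by (simp add: subst_simps)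
    then show ?thesis
      unfolding expandable_def using True mtyping_finite[of \<Gamma> N A]
      by (intro exI[of _ "{A}"]) (auto intro: mAx)
  next
    case False
    then show ?thesis
      unfolding expandable_def using Var by (intro exI[of _ "{}"]) (auto simp: subst_simps)
  qed
next
  case (App M1 M2)
  from App.prems(1) show ?case
    unfolding subst_simps
  proof (induction rule: mtyping_App_elim)
    case (ArrE B C)
    with App have "expandable \<Gamma> x N M1 (B \<^bold>\<rightarrow> C)" "expandable \<Gamma> x N M2 B" by auto
    then show ?case
      by (rule expandable_common) (auto simp: expandable_def intro: mArrE)
  qed (blast intro: expandable_IntI expandable_IntE)+
next
  case (Lam y0 M0)
  have "finite \<Gamma>" using Lam.prems mtyping_finite by blast
  then obtain y M where y: "y \<notin> Domain \<Gamma> \<union> FV N \<union> {x}" and eq: "Lam y0 M0 = Lam y M"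
    using Lam_fresh[of "Domain \<Gamma> \<union> FV N \<union> {x}" y0 M0] finite_FV
    by (metis finite_Domain finite_Un finite.emptyI finite.insertI)
  have "\<Gamma> \<turnstile>\<^sub>m Lam y (M[x ::= N]) \<Ztypecolon> A"
    using Lam.prems(1) y by (simp add: eq subst_simps)
  moreover have "y \<notin> Domain \<Gamma>" using y by simp
  ultimately show ?case
    unfolding eq
  proof (induction rule: mtyping_Lam_elim)
    case (ArrI B C)
    have "expandable (insert (y, B) \<Gamma>) x N M C"
      using Lam.IH[OF eq ArrI] Lam.prems(2) y by auto
    then obtain S where S: "finite S" "\<forall>D\<in>S. insert (y, B) \<Gamma> \<turnstile>\<^sub>m N \<Ztypecolon> D"
      "insert (y, B) \<Gamma> \<union> {x} \<times> S \<turnstile>\<^sub>m M \<Ztypecolon> C"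
      unfolding expandable_def by blast
    have "\<forall>D\<in>S. \<Gamma> \<turnstile>\<^sub>m N \<Ztypecolon> D"
      using S(2) y \<open>finite \<Gamma>\<close> by (auto intro: mtyping_cong_ctx)
    moreover have "\<Gamma> \<union> {x} \<times> S \<turnstile>\<^sub>m Lam y M \<Ztypecolon> B \<^bold>\<rightarrow> C"
      using S(3) y by (intro mArrI) auto
    ultimately show ?case
      unfolding expandable_def using S(1) by blast
  qed (blast intro: expandable_IntI expandable_IntE)+
qed

lemma mtyping_expansion:
  assumes "\<Gamma> \<turnstile>\<^sub>m M[x ::= N] \<Ztypecolon> A" "\<Gamma> \<turnstile>\<^sub>m N \<Ztypecolon> B"
  shows "\<Gamma> \<turnstile>\<^sub>m App (Lam x M) N \<Ztypecolon> A"
proof -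
  have fin: "finite \<Gamma>" using assms mtyping_finite by blast
  then obtain y M' where y: "y \<notin> Domain \<Gamma>" and eq: "Lam x M = Lam y M'"
    and "M'[y ::= N] = M[x ::= N]"
    using Lam_fresh[of "Domain \<Gamma>" x M] by (metis finite_Domain)
  then have "expandable \<Gamma> y N M' A"
    using assms(1) by (intro mtyping_subst_expandable) auto
  then obtain S where S: "finite S" "\<forall>C\<in>S. \<Gamma> \<turnstile>\<^sub>m N \<Ztypecolon> C" "\<Gamma> \<union> {y} \<times> S \<turnstile>\<^sub>m M' \<Ztypecolon> A"
    unfolding expandable_def by blast
  \<comment> \<open>Adding \<open>B\<close> makes the set nonempty even when \<open>N\<close> has no
    copy in the contractum, so an intersection exists. This is the purpose of the second premise of
    \<open>sBeta\<close>.\<close>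
  obtain D where D: "is_Inter (insert B S) D"
    using is_Inter_exists[of "insert B S"] S(1) by auto
  have "insert (y, D) \<Gamma> \<turnstile>\<^sub>m Var y \<Ztypecolon> D"
    using fin by (intro mAx) auto
  then have "\<forall>C\<in>S. insert (y, D) \<Gamma> \<turnstile>\<^sub>m Var y \<Ztypecolon> C"
    using mtyping_is_Inter[OF D] by blast
  \<comment> \<open>Substituting each variable for itself changes only the context: the assumptions
    with types in \<open>S\<close> are traded for the single type \<open>D\<close>.\<close>
  then have "insert (y, D) \<Gamma> \<turnstile>\<^sub>m msubst M' Var \<Ztypecolon> A"
    using fin by (intro mtyping_msubst[OF S(3)]) (auto intro: mAx)
  then have "\<Gamma> \<turnstile>\<^sub>m Lam y M' \<Ztypecolon> D \<^bold>\<rightarrow> A"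
    using y by (auto intro: mArrI)
  moreover have "\<Gamma> \<turnstile>\<^sub>m N \<Ztypecolon> D"
    using S(2) assms(2) mtyping_is_Inter[OF D] by blast
  ultimately show ?thesis
    unfolding eq by (rule mArrE)
qed

text \<open>Typings of an application depend on its head only through the types of the head, so an
  inclusion of types extends along the spine. This lifts the expansion of a redex to
  \<open>sBeta\<close> with further arguments.\<close>

lemma mtyping_apps_mono:
  "(\<And>A. \<Gamma> \<turnstile>\<^sub>m M \<Ztypecolon> A \<Longrightarrow> \<Gamma> \<turnstile>\<^sub>m M' \<Ztypecolon> A) \<Longrightarrow> \<Gamma> \<turnstile>\<^sub>m apps M Ns \<Ztypecolon> A \<Longrightarrow>
    \<Gamma> \<turnstile>\<^sub>m apps M' Ns \<Ztypecolon> A"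
proof (induction Ns arbitrary: M M')
  case (Cons N Ns)
  have "\<Gamma> \<turnstile>\<^sub>m App M' N \<Ztypecolon> B" if "\<Gamma> \<turnstile>\<^sub>m App M N \<Ztypecolon> B" for B
    using that by (induction rule: mtyping_App_elim) (blast intro: mtyping.intros Cons.prems(1))+
  then show ?case using Cons.IH[of "App M N" "App M' N"] Cons.prems by simp
qed simp

section \<open>From sequent derivations to natural deduction\<close>

lemma styping_imp_mtyping: "\<Gamma> \<turnstile>\<^sub>s M \<Ztypecolon> A \<Longrightarrow> \<Gamma> \<turnstile>\<^sub>m M \<Ztypecolon> A"
proof (induction rule: styping.induct)
  case (sAx \<Gamma> x A)
  then show ?case by (intro mAx) auto
next
  case (sBeta \<Gamma> M x N Ns A B)
  then show ?case using mtyping_expansion mtyping_apps_mono by blast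
next
  case (sArrL \<Gamma> N A1 y A2 Ns B x)
  \<comment> \<open>Since \<open>y\<close> is not free in \<open>Ns\<close>, substituting
    \<open>App (Var x) N\<close> for it alters only the head.\<close>
  let ?\<Delta> = "insert (x, A1 \<^bold>\<rightarrow> A2) \<Gamma>" and ?f = "Var(y := App (Var x) N)"
  have fin: "finite ?\<Delta>" using sArrL.IH mtyping_finite by auto
  have "?\<Delta> \<turnstile>\<^sub>m N \<Ztypecolon> A1"
    using fin by (auto intro: mtyping_cong_ctx[OF sArrL.IH(1)])
  then have "?\<Delta> \<turnstile>\<^sub>m App (Var x) N \<Ztypecolon> A2"
    using fin by (intro mArrE[of _ _ A1] mAx) auto
  then have "?\<Delta> \<turnstile>\<^sub>m msubst (apps (Var y) Ns) ?f \<Ztypecolon> B"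
    using fin sArrL.hyps by (intro mtyping_msubst[OF sArrL.IH(2)]) (auto intro: mAx)
  moreover have "map (\<lambda>P. msubst P ?f) Ns = Ns"
    using sArrL.hyps by (intro map_idI msubst_fresh) auto
  ultimately show ?case by (simp add: msubst_apps)
next
  case (sIntL x A1 A2 \<Gamma> Ns B)
  let ?\<Delta> = "insert (x, A1 \<^bold>\<inter> A2) \<Gamma>"
  have fin: "finite ?\<Delta>" using mtyping_finite[OF sIntL.IH] by simp
  have "?\<Delta> \<turnstile>\<^sub>m Var x \<Ztypecolon> A1 \<^bold>\<inter> A2" using fin by (intro mAx) auto
  then have "?\<Delta> \<turnstile>\<^sub>m msubst (apps (Var x) Ns) Var \<Ztypecolon> B"
    using fin by (intro mtyping_msubst[OF sIntL.IH]) (auto intro: mtyping.intros)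
  then show ?case by simp
qed (blast intro: mtyping.intros)+

section \<open>Reducibility over the sequent calculus\<close>

text \<open>\<open>f\<close> may identify variables, whose types then accumulate in the context.
  Weakening and the replacement of a fresh head variable by one of the context are both
  instances.\<close>

lemma styping_rename:
  assumes "\<Gamma> \<turnstile>\<^sub>s M \<Ztypecolon> A" "finite \<Gamma>'"
    and "\<And>x B. (x, B) \<in> \<Gamma> \<Longrightarrow> (f x, B) \<in> \<Gamma>'"
  shows "\<Gamma>' \<turnstile>\<^sub>s msubst M (\<lambda>x. Var (f x)) \<Ztypecolon> A"
  using assms
proof (induction arbitrary: \<Gamma>' f rule: styping.induct)
  case (sAx \<Gamma> x A)
  then show ?case using styping.sAx[of \<Gamma>' "f x" A] by (simp add: insert_absorb)
next
  case (sBeta \<Gamma> M x N Ns A B)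
  let ?f = "\<lambda>x. Var (f x)"
  obtain y where y: "msubst (Lam x M) ?f = Lam y (msubst M (?f(x := Var y)))"
    "\<And>P. (msubst M (?f(x := Var y)))[y ::= P] = msubst M (?f(x := P))"
    using msubst_Lam_fresh[of "{}" x M ?f] by (metis finite.emptyI)
  have "msubst (M[x ::= N]) ?f = msubst M (?f(x := msubst N ?f))"
    unfolding subst_eq_msubst msubst_msubst by (rule msubst_cong) auto
  then have "\<Gamma>' \<turnstile>\<^sub>s apps ((msubst M (?f(x := Var y)))[y ::= msubst N ?f]) (map (\<lambda>P. msubst P ?f) Ns) \<Ztypecolon> A"
    using sBeta.IH(1)[of \<Gamma>' f] sBeta.prems by (simp add: msubst_apps y(2))
  moreover have "\<Gamma>' \<turnstile>\<^sub>s msubst N ?f \<Ztypecolon> B"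
    using sBeta.prems by (intro sBeta.IH(2))
  ultimately show ?case
    using styping.sBeta by (simp add: msubst_apps y(1))
next
  case (sArrL \<Gamma> N A1 y A2 Ns B x)
  let ?f = "\<lambda>x. Var (f x)"
  let ?Ns = "map (\<lambda>P. msubst P ?f) Ns"
  \<comment> \<open>The head variable of the premise must be fresh for the new context and the
    renamed arguments, so \<open>y\<close> is sent to \<open>z\<close> instead of
    \<open>f y\<close>.\<close>
  obtain z where z: "z \<notin> Domain \<Gamma>'" "z \<notin> (\<Union>P\<in>set ?Ns. FV P)"
    using finite_Domain_fresh[OF sArrL.prems(1), of "\<Union>P\<in>set ?Ns. FV P"] finite_FV by auto
  have "insert (z, A2) \<Gamma>' \<turnstile>\<^sub>s msubst (apps (Var y) Ns) (\<lambda>x. Var ((f(y := z)) x)) \<Ztypecolon> B"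
    using sArrL.prems sArrL.hyps by (intro sArrL.IH(2)) auto
  moreover have "map (\<lambda>P. msubst P (\<lambda>x. Var ((f(y := z)) x))) Ns = ?Ns"
    using sArrL.hyps(3) by (auto intro!: msubst_cong)
  ultimately have *: "insert (z, A2) \<Gamma>' \<turnstile>\<^sub>s apps (Var z) ?Ns \<Ztypecolon> B"
    by (simp only: msubst_apps msubst_simps fun_upd_same)
  have "\<Gamma>' \<turnstile>\<^sub>s msubst N ?f \<Ztypecolon> A1"
    using sArrL.prems by (intro sArrL.IH(1)) auto
  from styping.sArrL[OF this * z(2,1), of "f x"] show ?case
    using sArrL.prems(2) by (simp add: msubst_apps insert_absorb)
next
  case (sArrR x A \<Gamma> M B)
  let ?f = "\<lambda>x. Var (f x)"
  obtain y where y: "y \<notin> Domain \<Gamma>'" "msubst (Lam x M) ?f = Lam y (msubst M (?f(x := Var y)))"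
    using msubst_Lam_fresh[of "Domain \<Gamma>'" x M ?f] sArrR.prems(1) by (metis finite_Domain)
  have "insert (y, A) \<Gamma>' \<turnstile>\<^sub>s msubst M (\<lambda>z. Var ((f(x := y)) z)) \<Ztypecolon> B"
    using sArrR.prems sArrR.hyps by (intro sArrR.IH) auto
  moreover have "(\<lambda>z. Var ((f(x := y)) z)) = ?f(x := Var y)" by auto
  ultimately show ?case
    unfolding y(2) using y(1) by (auto intro: styping.sArrR)
next
  case (sIntL x A1 A2 \<Gamma> Ns B)
  have "insert (f x, A1) (insert (f x, A2) \<Gamma>') \<turnstile>\<^sub>s msubst (apps (Var x) Ns) (\<lambda>x. Var (f x)) \<Ztypecolon> B"
    using sIntL.prems by (intro sIntL.IH) auto
  then show ?case
    using styping.sIntL[of "f x" A1 A2 \<Gamma>'] sIntL.prems(2) by (simp add: msubst_apps insert_absorb)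
next
  case (sIntR \<Gamma> M A B)
  then show ?case by (blast intro: styping.sIntR)
qed

lemma styping_weaken: "\<Gamma> \<turnstile>\<^sub>s M \<Ztypecolon> A \<Longrightarrow> finite \<Gamma>' \<Longrightarrow> \<Gamma> \<subseteq> \<Gamma>' \<Longrightarrow> \<Gamma>' \<turnstile>\<^sub>s M \<Ztypecolon> A"
  using styping_rename[of \<Gamma> M A \<Gamma>' "\<lambda>x. x"] by auto

section \<open>The reducibility relation and its closure properties\<close>

primrec red :: "'a ty \<Rightarrow> 'a ctx \<Rightarrow> tm \<Rightarrow> bool" where
  "red (Atom a) \<Gamma> M = (\<Gamma> \<turnstile>\<^sub>s M \<Ztypecolon> Atom a)"
| "red (A \<^bold>\<rightarrow> B) \<Gamma> M = (\<Gamma> \<turnstile>\<^sub>s M \<Ztypecolon> A \<^bold>\<rightarrow> B \<and>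
    (\<forall>\<Gamma>' N. \<Gamma> \<subseteq> \<Gamma>' \<longrightarrow> finite \<Gamma>' \<longrightarrow> red A \<Gamma>' N \<longrightarrow> red B \<Gamma>' (App M N)))"
| "red (A \<^bold>\<inter> B) \<Gamma> M = (red A \<Gamma> M \<and> red B \<Gamma> M)"

lemma red_imp_styping: "red A \<Gamma> M \<Longrightarrow> \<Gamma> \<turnstile>\<^sub>s M \<Ztypecolon> A"
  by (induction A) (auto intro: sIntR)

lemma red_weaken: "red A \<Gamma> M \<Longrightarrow> finite \<Gamma>' \<Longrightarrow> \<Gamma> \<subseteq> \<Gamma>' \<Longrightarrow> red A \<Gamma>' M"
  by (induction A) (auto intro: styping_weaken)

text \<open>The spine \<open>Ns\<close> is arbitrary because at an arrow type the test argument is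
  appended to it; the redex stays at the head, where \<open>sBeta\<close> applies.\<close>

lemma red_expansion:
  "red A \<Gamma> (apps (M[x ::= N]) Ns) \<Longrightarrow> finite \<Gamma> \<Longrightarrow> \<Gamma> \<turnstile>\<^sub>s N \<Ztypecolon> B \<Longrightarrow>
    red A \<Gamma> (apps (App (Lam x M) N) Ns)"
proof (induction A arbitrary: \<Gamma> Ns)
  case (Arrow A1 A2)
  have "red A2 \<Gamma>' (App (apps (App (Lam x M) N) Ns) P)"
    if "\<Gamma> \<subseteq> \<Gamma>'" "finite \<Gamma>'" "red A1 \<Gamma>' P" for \<Gamma>' P
    using Arrow.IH(2)[of \<Gamma>' "Ns @ [P]"] Arrow.prems that by (auto intro: styping_weaken)
  then show ?case using Arrow.prems by (auto intro: sBeta)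
qed (auto intro: sBeta)

text \<open>\<open>acts_like A \<Gamma> M\<close>: the term \<open>M\<close> may replace a fresh head variable of type \<open>A\<close>. This
  is the invariant by which variables are shown reducible, as the left rules of the calculus build
  applications from the inside of the spine towards its head.\<close>

definition acts_like :: "'a ty \<Rightarrow> 'a ctx \<Rightarrow> tm \<Rightarrow> bool" where
  "acts_like A \<Gamma> M \<longleftrightarrow> (\<forall>\<Gamma>' Ns C y. \<Gamma> \<subseteq> \<Gamma>' \<longrightarrow> finite \<Gamma>' \<longrightarrow> y \<notin> Domain \<Gamma>' \<longrightarrow>
    y \<notin> (\<Union>P\<in>set Ns. FV P) \<longrightarrow> insert (y, A) \<Gamma>' \<turnstile>\<^sub>s apps (Var y) Ns \<Ztypecolon> C \<longrightarrow>
    \<Gamma>' \<turnstile>\<^sub>s apps M Ns \<Ztypecolon> C)"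

lemma acts_likeI:
  assumes "\<And>\<Gamma>' Ns C y. \<lbrakk>\<Gamma> \<subseteq> \<Gamma>'; finite \<Gamma>'; y \<notin> Domain \<Gamma>'; y \<notin> (\<Union>P\<in>set Ns. FV P);
    insert (y, A) \<Gamma>' \<turnstile>\<^sub>s apps (Var y) Ns \<Ztypecolon> C\<rbrakk> \<Longrightarrow> \<Gamma>' \<turnstile>\<^sub>s apps M Ns \<Ztypecolon> C"
  shows "acts_like A \<Gamma> M"
  unfolding acts_like_def by (intro allI impI) (rule assms)

lemma acts_likeD:
  "\<lbrakk>acts_like A \<Gamma> M; \<Gamma> \<subseteq> \<Gamma>'; finite \<Gamma>'; y \<notin> Domain \<Gamma>'; y \<notin> (\<Union>P\<in>set Ns. FV P);
    insert (y, A) \<Gamma>' \<turnstile>\<^sub>s apps (Var y) Ns \<Ztypecolon> C\<rbrakk> \<Longrightarrow> \<Gamma>' \<turnstile>\<^sub>s apps M Ns \<Ztypecolon> C"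
  unfolding acts_like_def by blast

text \<open>Renaming \<open>y\<close> to \<open>x\<close> merges the assumption on \<open>y\<close>
  with one already present and leaves \<open>Ns\<close> unchanged.\<close>

lemma acts_like_Var: "(x, A) \<in> \<Gamma> \<Longrightarrow> acts_like A \<Gamma> (Var x)"
proof (rule acts_likeI)
  fix \<Gamma>' Ns C y
  assume *: "(x, A) \<in> \<Gamma>" "\<Gamma> \<subseteq> \<Gamma>'" "finite \<Gamma>'" "y \<notin> Domain \<Gamma>'" "y \<notin> (\<Union>P\<in>set Ns. FV P)"
    "insert (y, A) \<Gamma>' \<turnstile>\<^sub>s apps (Var y) Ns \<Ztypecolon> C"
  let ?f = "\<lambda>z. Var ((id(y := x)) z)"
  have "\<Gamma>' \<turnstile>\<^sub>s msubst (apps (Var y) Ns) ?f \<Ztypecolon> C"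
    using * by (intro styping_rename[OF *(6)]) auto
  moreover have "map (\<lambda>P. msubst P ?f) Ns = Ns"
    using *(5) by (intro map_idI msubst_fresh) auto
  ultimately show "\<Gamma>' \<turnstile>\<^sub>s apps (Var x) Ns \<Ztypecolon> C"
    by (simp add: msubst_apps)
qed

text \<open>The case of the empty spine, starting from an axiom for a fresh variable.\<close>

lemma acts_like_styping:
  assumes "acts_like A \<Gamma> M" "finite \<Gamma>"
  shows "\<Gamma> \<turnstile>\<^sub>s M \<Ztypecolon> A"
proof -
  obtain y where "y \<notin> Domain \<Gamma>"
    using finite_Domain_fresh[OF assms(2), of "{}"] by auto
  then show ?thesis
    using acts_likeD[OF assms(1), of \<Gamma> y "[]" A] assms(2) sAx[of \<Gamma> y A] by simp
qed

text \<open>A derivation with head \<open>y\<close> and spine \<open>Ns\<close> becomes, by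
  \<open>sArrL\<close>, one with a fresh head \<open>z\<close> of arrow type and spine
  \<open>N # Ns\<close>; then \<open>M\<close> may replace \<open>z\<close>.\<close>

lemma acts_like_App:
  assumes "acts_like (A \<^bold>\<rightarrow> B) \<Gamma> M" "\<Gamma> \<turnstile>\<^sub>s N \<Ztypecolon> A"
  shows "acts_like B \<Gamma> (App M N)"
proof (rule acts_likeI)
  fix \<Gamma>' Ns C y
  assume *: "\<Gamma> \<subseteq> \<Gamma>'" "finite \<Gamma>'" "y \<notin> Domain \<Gamma>'" "y \<notin> (\<Union>P\<in>set Ns. FV P)"
    "insert (y, B) \<Gamma>' \<turnstile>\<^sub>s apps (Var y) Ns \<Ztypecolon> C"
  obtain z where z: "z \<notin> Domain \<Gamma>'" "z \<notin> (\<Union>P\<in>set (N # Ns). FV P)"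
    using finite_Domain_fresh[OF *(2), of "\<Union>P\<in>set (N # Ns). FV P"] finite_FV by auto
  have "insert (z, A \<^bold>\<rightarrow> B) \<Gamma>' \<turnstile>\<^sub>s apps (Var z) (N # Ns) \<Ztypecolon> C"
    using sArrL[OF styping_weaken[OF assms(2) *(2,1)] *(5,4,3)] by simp
  from acts_likeD[OF assms(1) *(1,2) z this] show "\<Gamma>' \<turnstile>\<^sub>s apps (App M N) Ns \<Ztypecolon> C"
    by simp
qed

text \<open>After weakening by the other component, \<open>sIntL\<close> gives the head variable the
  intersection type.\<close>

lemma acts_like_Inter:
  assumes "acts_like (A \<^bold>\<inter> B) \<Gamma> M"
  shows "acts_like A \<Gamma> M" "acts_like B \<Gamma> M"
proof -
  have "acts_like C \<Gamma> M" if "C \<in> {A, B}" for C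
  proof (rule acts_likeI)
    fix \<Gamma>' Ns D y
    assume *: "\<Gamma> \<subseteq> \<Gamma>'" "finite \<Gamma>'" "y \<notin> Domain \<Gamma>'" "y \<notin> (\<Union>P\<in>set Ns. FV P)"
      "insert (y, C) \<Gamma>' \<turnstile>\<^sub>s apps (Var y) Ns \<Ztypecolon> D"
    have "insert (y, A) (insert (y, B) \<Gamma>') \<turnstile>\<^sub>s apps (Var y) Ns \<Ztypecolon> D"
      using that *(2) by (intro styping_weaken[OF *(5)]) auto
    then show "\<Gamma>' \<turnstile>\<^sub>s apps M Ns \<Ztypecolon> D"
      by (intro acts_likeD[OF assms *(1-4)] sIntL)
  qed
  then show "acts_like A \<Gamma> M" "acts_like B \<Gamma> M" by simp_all
qed

lemma acts_like_weaken: "acts_like A \<Gamma> M \<Longrightarrow> \<Gamma> \<subseteq> \<Gamma>' \<Longrightarrow> acts_like A \<Gamma>' M"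
  unfolding acts_like_def by (meson order_trans)

text \<open>At an arrow type a reducible argument enters \<open>acts_like_App\<close> only through
  its derivability, and the application then satisfies the invariant at the smaller type
  \<open>B\<close>.\<close>

lemma acts_like_imp_red: "acts_like A \<Gamma> M \<Longrightarrow> finite \<Gamma> \<Longrightarrow> red A \<Gamma> M"
proof (induction A arbitrary: \<Gamma> M)
  case (Atom a)
  then show ?case by (simp add: acts_like_styping)
next
  case (Arrow A B)
  have "red B \<Gamma>' (App M N)" if "\<Gamma> \<subseteq> \<Gamma>'" "finite \<Gamma>'" "red A \<Gamma>' N" for \<Gamma>' N
    using Arrow.IH(2)[OF acts_like_App[OF acts_like_weaken[OF Arrow.prems(1)] red_imp_styping]] that
    by blast
  then show ?case
    using acts_like_styping[OF Arrow.prems] by simp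
next
  case (Inter A B)
  then show ?case by (auto dest: acts_like_Inter)
qed

lemma red_Var: "(x, A) \<in> \<Gamma> \<Longrightarrow> finite \<Gamma> \<Longrightarrow> red A \<Gamma> (Var x)"
  by (intro acts_like_imp_red acts_like_Var)

text \<open>The fundamental lemma of the logical relation: elimination rules match the clauses of
  \<open>red\<close>, and abstractions are handled by closure under head expansion.\<close>

lemma typing_imp_red:
  assumes "\<Delta> \<turnstile> M \<Ztypecolon> A" "finite \<Gamma>" "\<And>x B. (x, B) \<in> \<Delta> \<Longrightarrow> red B \<Gamma> (f x)"
  shows "red A \<Gamma> (msubst M f)"
  using assms
proof (induction arbitrary: \<Gamma> f rule: typing.induct)
  case (ArrI x A \<Delta> M B)
  obtain y where y: "y \<notin> Domain \<Gamma>" "msubst (Lam x M) f = Lam y (msubst M (f(x := Var y)))"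
    "\<And>N. (msubst M (f(x := Var y)))[y ::= N] = msubst M (f(x := N))"
    using msubst_Lam_fresh[of "Domain \<Gamma>" x M f] ArrI.prems(1) by (metis finite_Domain)
  have *: "red B \<Gamma>' (msubst M (f(x := N)))" if "\<Gamma> \<subseteq> \<Gamma>'" "finite \<Gamma>'" "red A \<Gamma>' N" for \<Gamma>' N
    using that ArrI.hyps ArrI.prems
    by (intro ArrI.IH) (auto intro: red_weaken[of _ \<Gamma>])
  \<comment> \<open>The derivability half of the arrow clause comes from taking the fresh variable
    \<open>y\<close> itself as reducible argument.\<close>
  have "insert (y, A) \<Gamma> \<turnstile>\<^sub>s msubst M (f(x := Var y)) \<Ztypecolon> B"
    using ArrI.prems(1) by (intro red_imp_styping * red_Var) auto
  then have "\<Gamma> \<turnstile>\<^sub>s Lam y (msubst M (f(x := Var y))) \<Ztypecolon> A \<^bold>\<rightarrow> B"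
    using y(1) by (rule sArrR)
  moreover have "red B \<Gamma>' (App (Lam y (msubst M (f(x := Var y)))) N)"
    if "\<Gamma> \<subseteq> \<Gamma>'" "finite \<Gamma>'" "red A \<Gamma>' N" for \<Gamma>' N
    using red_expansion[of B \<Gamma>' "msubst M (f(x := Var y))" y N "[]" A] *[OF that] that
    by (simp add: y(3) red_imp_styping)
  ultimately show ?case unfolding y(2) by simp
next
  case (ArrE \<Delta> M A B N)
  then show ?case by fastforce
qed auto

lemma red_is_Inter:
  assumes "is_Inter S A"
  shows "red A \<Gamma> M \<longleftrightarrow> (\<forall>C\<in>S. red C \<Gamma> M)"
  using assms by induction auto

theorem theorem3:
  fixes \<Gamma> \<Delta> :: "'a ctx" and M :: tm and A :: "'a ty"
  assumes "finite \<Gamma>" and "is_inter_ctx \<Gamma> \<Delta>"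
  shows "\<Gamma> \<turnstile>\<^sub>s M \<Ztypecolon> A \<longleftrightarrow> \<Delta> \<turnstile> M \<Ztypecolon> A"
proof
  have \<Delta>: "single_valued \<Delta>" "Domain \<Delta> = Domain \<Gamma>"
    "\<And>x A. (x, A) \<in> \<Delta> \<Longrightarrow> is_Inter {B. (x, B) \<in> \<Gamma>} A"
    using assms(2) unfolding is_inter_ctx_def by auto
  have fin: "finite \<Delta>" using assms by (rule is_inter_ctx_finite)
  assume "\<Gamma> \<turnstile>\<^sub>s M \<Ztypecolon> A"
  then have "\<Gamma> \<turnstile>\<^sub>m M \<Ztypecolon> A" by (rule styping_imp_mtyping)
  moreover have "\<Delta> \<turnstile>\<^sub>m Var x \<Ztypecolon> B" if xB: "(x, B) \<in> \<Gamma>" for x B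
  proof -
    obtain C where C: "(x, C) \<in> \<Delta>" using \<Delta>(2) xB by (metis Domain_iff)
    show ?thesis
      using mtyping_is_Inter[OF \<Delta>(3)[OF C]] mAx[OF fin C] xB by blast
  qed
  \<comment> \<open>The identity substitution exchanges the context: each assumption of
    \<open>\<Gamma>\<close> is derived from the intersection in \<open>\<Delta>\<close>.\<close>
  ultimately have "\<Delta> \<turnstile>\<^sub>m msubst M Var \<Ztypecolon> A"
    using fin by (intro mtyping_msubst)
  then show "\<Delta> \<turnstile> M \<Ztypecolon> A"
    using \<Delta>(1) by (auto intro: mtyping_imp_typing)
next
  assume "\<Delta> \<turnstile> M \<Ztypecolon> A"
  moreover have "red B \<Gamma> (Var x)" if "(x, B) \<in> \<Delta>" for x B
  proof -
    have "is_Inter {B. (x, B) \<in> \<Gamma>} B"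
      using assms(2) that unfolding is_inter_ctx_def by blast
    then show ?thesis
      using red_is_Inter red_Var assms(1) by blast
  qed
  \<comment> \<open>The identity substitution is reducible in \<open>\<Gamma>\<close> because
    \<open>red\<close> at an intersection is the conjunction over its components, each assumed in
    \<open>\<Gamma>\<close>.\<close>
  ultimately have "red A \<Gamma> (msubst M Var)"
    using assms(1) by (intro typing_imp_red)
  then show "\<Gamma> \<turnstile>\<^sub>s M \<Ztypecolon> A"
    by (simp add: red_imp_styping)
qed

end
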